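(* Let $(M,\phi,\xi,\eta,g)$ be a nearly Sasakian manifold and let $h$ be defined by $\nabla_X\xi=-\phi X+hX$. Fix a real number $r$. Then there exists a unique linear connection $\bar\nabla$ which parallelizes all the structure tensors $\phi,\xi,\eta,g$ and such that the torsion tensor $\bar T$ of $\bar\nabla$ satisfies the following conditions: 1) $\bar T$ is totally skew-symmetric on $\mathcal D=\ker(\eta)$; 2) the $(1,1)$-tensor field $\tau$ defined by $\tau X=\bar T(\xi,X)$ satisfies $\tau\phi+\phi\tau=-2(r+1)\phi^2$. This linear connection is given by $\bar\nabla_XY=\nabla_XY+H(X,Y)$, where $$H(X,Y)=\tfrac12(\nabla_X\phi)\phi Y-r\,\eta(X)\phi Y+\eta(Y)(\phi-h)X-\tfrac12 g((\phi-h)X,Y)\xi.$$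
   Context: All manifolds are smooth and connected; $\nabla$ is the Levi-Civita connection of $g$. An almost contact metric structure $(\phi,\xi,\eta,g)$ on $M^{2n+1}$ consists of a $(1,1)$-tensor field $\phi$, a vector field $\xi$, a $1$-form $\eta$ and a Riemannian metric $g$ with $\phi^2=-I+\eta\otimes\xi$, $\eta(\xi)=1$, $g(\phi X,\phi Y)=g(X,Y)-\eta(X)\eta(Y)$. It is nearly Sasakian if $(\nabla_X\phi)Y+(\nabla_Y\phi)X=2g(X,Y)\xi-\eta(X)Y-\eta(Y)X$ for all vector fields $X,Y$ (Sasakian structures are allowed). "$\bar T$ is totally skew-symmetric on $\mathcal D$" means that $\bar T(X,Y,Z):=g(\bar T(X,Y),Z)$ is totally skew-symmetric for $X,Y,Z\in\mathcal D$. *)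

theory Defs
  imports "HOL-Analysis.Analysis" "HOL-Library.Function_Algebras"
begin

text \<open>
  Sums and differences of vector fields and of functions are the pointwise ones of
  \<^theory>\<open>HOL-Library.Function_Algebras\<close>.
\<close>

section \<open>Smooth manifolds\<close>

text \<open>The class \<open>C\<^sup>k\<close> on an open subset of a Euclidean space.\<close>

fun Ck_on :: "nat \<Rightarrow> 'a::euclidean_space set \<Rightarrow> ('a \<Rightarrow> 'b::euclidean_space) \<Rightarrow> bool" where
  "Ck_on 0 S f \<longleftrightarrow> continuous_on S f"
| "Ck_on (Suc k) S f \<longleftrightarrow>
     (\<forall>x\<in>S. f differentiable (at x)) \<and> (\<forall>v. Ck_on k S (\<lambda>x. frechet_derivative f (at x) v))"

definition smooth_on :: "'a::euclidean_space set \<Rightarrow> ('a \<Rightarrow> 'b::euclidean_space) \<Rightarrow> bool" where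
  "smooth_on S f \<longleftrightarrow> (\<forall>k. Ck_on k S f)"

type_synonym ('m, 'e) atlas = "('m set \<times> ('m \<Rightarrow> 'e)) set"

text \<open>
  The manifold is the whole type \<open>'m\<close>; a chart is a pair of its domain and its coordinate map.
  The Hausdorff and second countability axioms are the type classes of \<open>'m\<close>, and the dimension
  is that of the model space \<open>'e\<close>. The atlas need not be maximal.
\<close>

definition smooth_manifold ::
  "('m::{t2_space, second_countable_topology}, 'e::euclidean_space) atlas \<Rightarrow> bool" where
  "smooth_manifold A \<longleftrightarrow>
     connected (UNIV :: 'm set) \<and>
     (\<Union>(U, \<kappa>)\<in>A. U) = UNIV \<and>
     (\<forall>(U, \<kappa>)\<in>A. open U \<and> open (\<kappa> ` U) \<and> homeomorphism U (\<kappa> ` U) \<kappa> (inv_into U \<kappa>)) \<and>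
     (\<forall>(U, \<kappa>)\<in>A. \<forall>(V, \<mu>)\<in>A. smooth_on (\<kappa> ` (U \<inter> V)) (\<mu> \<circ> inv_into U \<kappa>))"

definition smooth_functions :: "('m, 'e::euclidean_space) atlas \<Rightarrow> ('m \<Rightarrow> real) set" where
  "smooth_functions A = {f. \<forall>(U, \<kappa>)\<in>A. smooth_on (\<kappa> ` U) (f \<circ> inv_into U \<kappa>)}"

text \<open>
  Tangent vectors at \<open>p\<close> are the derivations at \<open>p\<close> of the algebra of smooth functions. They
  are totalised by the value \<open>0\<close> on non-smooth functions, so that equality of tangent vectors
  is equality of derivations.
\<close>

type_synonym 'm tvec = "('m \<Rightarrow> real) \<Rightarrow> real"
type_synonym 'm vfield = "'m \<Rightarrow> 'm tvec"

definition tangent_space :: "('m, 'e::euclidean_space) atlas \<Rightarrow> 'm \<Rightarrow> 'm tvec set" where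
  "tangent_space A p = {v.
     (\<forall>f\<in>smooth_functions A. \<forall>g\<in>smooth_functions A. v (\<lambda>q. f q + g q) = v f + v g) \<and>
     (\<forall>c. \<forall>f\<in>smooth_functions A. v (\<lambda>q. c * f q) = c * v f) \<and>
     (\<forall>f\<in>smooth_functions A. \<forall>g\<in>smooth_functions A.
        v (\<lambda>q. f q * g q) = f p * v g + g p * v f) \<and>
     (\<forall>f. f \<notin> smooth_functions A \<longrightarrow> v f = 0)}"

definition deriv_along :: "'m vfield \<Rightarrow> ('m \<Rightarrow> real) \<Rightarrow> 'm \<Rightarrow> real" where
  "deriv_along X f = (\<lambda>p. X p f)"

definition vector_fields :: "('m, 'e::euclidean_space) atlas \<Rightarrow> 'm vfield set" where
  "vector_fields A = {X. (\<forall>p. X p \<in> tangent_space A p) \<and>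
     (\<forall>f\<in>smooth_functions A. deriv_along X f \<in> smooth_functions A)}"

definition fscale :: "('m \<Rightarrow> real) \<Rightarrow> 'm vfield \<Rightarrow> 'm vfield" (infixr "\<odot>" 75) where
  "f \<odot> X = (\<lambda>p k. f p * X p k)"

definition lie_bracket :: "'m vfield \<Rightarrow> 'm vfield \<Rightarrow> 'm vfield" where
  "lie_bracket X Y =
     (\<lambda>p f. deriv_along X (deriv_along Y f) p - deriv_along Y (deriv_along X f) p)"

section \<open>Tensor fields\<close>

text \<open>
  Tensor fields are families of (multi)linear maps on the tangent spaces which send smooth vector
  fields to smooth objects. Their values off the tangent spaces are irrelevant.
\<close>

definition ev :: "('m \<Rightarrow> 'm tvec \<Rightarrow> 'b) \<Rightarrow> 'm vfield \<Rightarrow> 'm \<Rightarrow> 'b" (infixr "\<triangleright>" 80) where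
  "T \<triangleright> X = (\<lambda>p. T p (X p))"

definition ev2 :: "('m \<Rightarrow> 'm tvec \<Rightarrow> 'm tvec \<Rightarrow> real) \<Rightarrow> 'm vfield \<Rightarrow> 'm vfield \<Rightarrow> 'm \<Rightarrow> real" where
  "ev2 g X Y = (\<lambda>p. g p (X p) (Y p))"

definition one_form ::
  "('m, 'e::euclidean_space) atlas \<Rightarrow> ('m \<Rightarrow> 'm tvec \<Rightarrow> real) \<Rightarrow> bool" where
  "one_form A \<eta> \<longleftrightarrow>
     (\<forall>p. \<forall>v\<in>tangent_space A p. \<forall>w\<in>tangent_space A p. \<eta> p (v + w) = \<eta> p v + \<eta> p w) \<and>
     (\<forall>p c. \<forall>v\<in>tangent_space A p. \<eta> p (\<lambda>f. c * v f) = c * \<eta> p v) \<and>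
     (\<forall>X\<in>vector_fields A. \<eta> \<triangleright> X \<in> smooth_functions A)"

definition endo_field ::
  "('m, 'e::euclidean_space) atlas \<Rightarrow> ('m \<Rightarrow> 'm tvec \<Rightarrow> 'm tvec) \<Rightarrow> bool" where
  "endo_field A \<phi> \<longleftrightarrow>
     (\<forall>p. \<forall>v\<in>tangent_space A p. \<phi> p v \<in> tangent_space A p) \<and>
     (\<forall>p. \<forall>v\<in>tangent_space A p. \<forall>w\<in>tangent_space A p. \<phi> p (v + w) = \<phi> p v + \<phi> p w) \<and>
     (\<forall>p c. \<forall>v\<in>tangent_space A p. \<phi> p (\<lambda>f. c * v f) = (\<lambda>f. c * \<phi> p v f)) \<and>
     (\<forall>X\<in>vector_fields A. \<phi> \<triangleright> X \<in> vector_fields A)"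

definition riemannian_metric ::
  "('m, 'e::euclidean_space) atlas \<Rightarrow> ('m \<Rightarrow> 'm tvec \<Rightarrow> 'm tvec \<Rightarrow> real) \<Rightarrow> bool" where
  "riemannian_metric A g \<longleftrightarrow>
     (\<forall>p. \<forall>v\<in>tangent_space A p. \<forall>w\<in>tangent_space A p. g p v w = g p w v) \<and>
     (\<forall>p. \<forall>u\<in>tangent_space A p. \<forall>v\<in>tangent_space A p. \<forall>w\<in>tangent_space A p.
        g p (u + v) w = g p u w + g p v w) \<and>
     (\<forall>p c. \<forall>v\<in>tangent_space A p. \<forall>w\<in>tangent_space A p.
        g p (\<lambda>f. c * v f) w = c * g p v w) \<and>
     (\<forall>p. \<forall>v\<in>tangent_space A p. v \<noteq> 0 \<longrightarrow> g p v v > 0) \<and>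
     (\<forall>X\<in>vector_fields A. \<forall>Y\<in>vector_fields A. ev2 g X Y \<in> smooth_functions A)"

section \<open>Linear connections\<close>

type_synonym 'm conn = "'m vfield \<Rightarrow> 'm vfield \<Rightarrow> 'm vfield"

text \<open>
  A connection is \<open>undefined\<close> off the smooth vector fields (\<open>\<rightarrow>\<^sub>E\<close>), so that equality
  of connections is equality on smooth vector fields.
\<close>

definition linear_connection :: "('m, 'e::euclidean_space) atlas \<Rightarrow> 'm conn \<Rightarrow> bool" where
  "linear_connection A D \<longleftrightarrow>
     D \<in> vector_fields A \<rightarrow>\<^sub>E vector_fields A \<rightarrow>\<^sub>E vector_fields A \<and>
     (\<forall>X\<in>vector_fields A. \<forall>X'\<in>vector_fields A. \<forall>Y\<in>vector_fields A.
        D (X + X') Y = D X Y + D X' Y) \<and>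
     (\<forall>f\<in>smooth_functions A. \<forall>X\<in>vector_fields A. \<forall>Y\<in>vector_fields A.
        D (f \<odot> X) Y = f \<odot> D X Y) \<and>
     (\<forall>X\<in>vector_fields A. \<forall>Y\<in>vector_fields A. \<forall>Y'\<in>vector_fields A.
        D X (Y + Y') = D X Y + D X Y') \<and>
     (\<forall>f\<in>smooth_functions A. \<forall>X\<in>vector_fields A. \<forall>Y\<in>vector_fields A.
        D X (f \<odot> Y) = deriv_along X f \<odot> Y + f \<odot> D X Y)"

definition torsion :: "'m conn \<Rightarrow> 'm vfield \<Rightarrow> 'm vfield \<Rightarrow> 'm vfield" where
  "torsion D X Y = D X Y - D Y X - lie_bracket X Y"

text \<open>Covariant derivatives \<open>(D\<^sub>X \<phi>) Y\<close>, \<open>(D\<^sub>X \<eta>) Y\<close> and \<open>(D\<^sub>X g) (Y, Z)\<close>.\<close>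

definition cov_endo :: "'m conn \<Rightarrow> ('m \<Rightarrow> 'm tvec \<Rightarrow> 'm tvec) \<Rightarrow>
    'm vfield \<Rightarrow> 'm vfield \<Rightarrow> 'm vfield" where
  "cov_endo D \<phi> X Y = D X (\<phi> \<triangleright> Y) - \<phi> \<triangleright> D X Y"

definition cov_form :: "'m conn \<Rightarrow> ('m \<Rightarrow> 'm tvec \<Rightarrow> real) \<Rightarrow>
    'm vfield \<Rightarrow> 'm vfield \<Rightarrow> 'm \<Rightarrow> real" where
  "cov_form D \<eta> X Y = deriv_along X (\<eta> \<triangleright> Y) - \<eta> \<triangleright> D X Y"

definition cov_metric :: "'m conn \<Rightarrow> ('m \<Rightarrow> 'm tvec \<Rightarrow> 'm tvec \<Rightarrow> real) \<Rightarrow>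
    'm vfield \<Rightarrow> 'm vfield \<Rightarrow> 'm vfield \<Rightarrow> 'm \<Rightarrow> real" where
  "cov_metric D g X Y Z = deriv_along X (ev2 g Y Z) - ev2 g (D X Y) Z - ev2 g Y (D X Z)"

definition levi_civita :: "('m, 'e::euclidean_space) atlas \<Rightarrow>
    ('m \<Rightarrow> 'm tvec \<Rightarrow> 'm tvec \<Rightarrow> real) \<Rightarrow> 'm conn \<Rightarrow> bool" where
  "levi_civita A g D \<longleftrightarrow>
     linear_connection A D \<and>
     (\<forall>X\<in>vector_fields A. \<forall>Y\<in>vector_fields A. torsion D X Y = 0) \<and>
     (\<forall>X\<in>vector_fields A. \<forall>Y\<in>vector_fields A. \<forall>Z\<in>vector_fields A. cov_metric D g X Y Z = 0)"

section \<open>Nearly Sasakian structures\<close>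

definition almost_contact_metric :: "('m, 'e::euclidean_space) atlas \<Rightarrow>
    ('m \<Rightarrow> 'm tvec \<Rightarrow> 'm tvec) \<Rightarrow> 'm vfield \<Rightarrow> ('m \<Rightarrow> 'm tvec \<Rightarrow> real) \<Rightarrow>
    ('m \<Rightarrow> 'm tvec \<Rightarrow> 'm tvec \<Rightarrow> real) \<Rightarrow> bool" where
  "almost_contact_metric A \<phi> \<xi> \<eta> g \<longleftrightarrow>
     endo_field A \<phi> \<and> \<xi> \<in> vector_fields A \<and> one_form A \<eta> \<and> riemannian_metric A g \<and>
     (\<forall>p. \<forall>v\<in>tangent_space A p. \<phi> p (\<phi> p v) = - v + (\<lambda>f. \<eta> p v * \<xi> p f)) \<and>
     (\<forall>p. \<eta> p (\<xi> p) = 1) \<and>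
     (\<forall>p. \<forall>v\<in>tangent_space A p. \<forall>w\<in>tangent_space A p.
        g p (\<phi> p v) (\<phi> p w) = g p v w - \<eta> p v * \<eta> p w)"

text \<open>The last argument of \<open>nearly_sasakian\<close> is the Levi-Civita connection of \<open>g\<close>.\<close>

definition nearly_sasakian :: "('m, 'e::euclidean_space) atlas \<Rightarrow>
    ('m \<Rightarrow> 'm tvec \<Rightarrow> 'm tvec) \<Rightarrow> 'm vfield \<Rightarrow> ('m \<Rightarrow> 'm tvec \<Rightarrow> real) \<Rightarrow>
    ('m \<Rightarrow> 'm tvec \<Rightarrow> 'm tvec \<Rightarrow> real) \<Rightarrow> 'm conn \<Rightarrow> bool" where
  "nearly_sasakian A \<phi> \<xi> \<eta> g nabla \<longleftrightarrow>
     almost_contact_metric A \<phi> \<xi> \<eta> g \<and> levi_civita A g nabla \<and>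
     (\<forall>X\<in>vector_fields A. \<forall>Y\<in>vector_fields A.
        cov_endo nabla \<phi> X Y + cov_endo nabla \<phi> Y X =
          (\<lambda>p. 2 * ev2 g X Y p) \<odot> \<xi> - (\<eta> \<triangleright> X) \<odot> Y - (\<eta> \<triangleright> Y) \<odot> X)"

definition parallelizes :: "('m, 'e::euclidean_space) atlas \<Rightarrow>
    ('m \<Rightarrow> 'm tvec \<Rightarrow> 'm tvec) \<Rightarrow> 'm vfield \<Rightarrow> ('m \<Rightarrow> 'm tvec \<Rightarrow> real) \<Rightarrow>
    ('m \<Rightarrow> 'm tvec \<Rightarrow> 'm tvec \<Rightarrow> real) \<Rightarrow> 'm conn \<Rightarrow> bool" where
  "parallelizes A \<phi> \<xi> \<eta> g D \<longleftrightarrow>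
     (\<forall>X\<in>vector_fields A. \<forall>Y\<in>vector_fields A. cov_endo D \<phi> X Y = 0) \<and>
     (\<forall>X\<in>vector_fields A. D X \<xi> = 0) \<and>
     (\<forall>X\<in>vector_fields A. \<forall>Y\<in>vector_fields A. cov_form D \<eta> X Y = 0) \<and>
     (\<forall>X\<in>vector_fields A. \<forall>Y\<in>vector_fields A. \<forall>Z\<in>vector_fields A. cov_metric D g X Y Z = 0)"

text \<open>Smooth sections of the distribution \<open>ker \<eta>\<close>.\<close>

definition ker_sections ::
  "('m, 'e::euclidean_space) atlas \<Rightarrow> ('m \<Rightarrow> 'm tvec \<Rightarrow> real) \<Rightarrow> 'm vfield set" where
  "ker_sections A \<eta> = {X \<in> vector_fields A. \<eta> \<triangleright> X = 0}"

text \<open>The two transpositions below generate all permutations of the three arguments.\<close>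

definition totally_skew_on ::
  "'m vfield set \<Rightarrow> ('m vfield \<Rightarrow> 'm vfield \<Rightarrow> 'm vfield \<Rightarrow> 'm \<Rightarrow> real) \<Rightarrow> bool" where
  "totally_skew_on \<Gamma> B \<longleftrightarrow>
     (\<forall>X\<in>\<Gamma>. \<forall>Y\<in>\<Gamma>. \<forall>Z\<in>\<Gamma>. B Y X Z = - B X Y Z \<and> B X Z Y = - B X Y Z)"

text \<open>
  The requirements on the connection: it parallelizes the structure, its torsion is totally
  skew-symmetric on \<open>ker \<eta>\<close>, and \<open>\<tau> = T(\<xi>, \<cdot>)\<close> satisfies
  \<open>\<tau>\<phi> + \<phi>\<tau> = -2(r + 1)\<phi>\<^sup>2\<close>. Here \<open>\<tau>\<close> acts on vector fields, so the term \<open>\<phi>\<tau>X\<close> is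
  \<open>\<phi> \<triangleright> torsion D \<xi> X\<close>.
\<close>

definition adapted_connection :: "('m, 'e::euclidean_space) atlas \<Rightarrow>
    ('m \<Rightarrow> 'm tvec \<Rightarrow> 'm tvec) \<Rightarrow> 'm vfield \<Rightarrow> ('m \<Rightarrow> 'm tvec \<Rightarrow> real) \<Rightarrow>
    ('m \<Rightarrow> 'm tvec \<Rightarrow> 'm tvec \<Rightarrow> real) \<Rightarrow> real \<Rightarrow> 'm conn \<Rightarrow> bool" where
  "adapted_connection A \<phi> \<xi> \<eta> g r D \<longleftrightarrow>
     linear_connection A D \<and> parallelizes A \<phi> \<xi> \<eta> g D \<and>
     totally_skew_on (ker_sections A \<eta>) (\<lambda>X Y Z. ev2 g (torsion D X Y) Z) \<and>
     (let \<tau> = torsion D \<xi> in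
        \<forall>X\<in>vector_fields A. \<tau> (\<phi> \<triangleright> X) + \<phi> \<triangleright> \<tau> X = (\<lambda>p. - 2 * (r + 1)) \<odot> \<phi> \<triangleright> \<phi> \<triangleright> X)"

end

theory Submission
  imports Defs
begin

text \<open>
  Write \<open>N X = \<nabla>\<^sub>X \<xi> = - (\<phi> - h) X\<close>. Differentiating \<open>\<phi>\<^sup>2 = - I + \<eta> \<otimes> \<xi>\<close>
  and the skew-symmetry of \<open>\<phi>\<close> shows that \<open>\<nabla> + H\<close> parallelizes the structure for every
  almost contact metric structure. The nearly Sasakian identity makes \<open>g((\<nabla>\<^sub>X \<phi>) Y, Z)\<close> a
  3-form on \<open>ker \<eta>\<close>, which gives the skew-symmetry of the torsion there. Taking \<open>\<xi>\<close> as one of the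
  arguments of the identity gives \<open>\<nabla>\<^sub>\<xi> \<phi> = \<phi> h\<close> and then \<open>h \<phi> + \<phi> h = 0\<close>, whence the condition
  on \<open>\<tau>\<close>.

  For uniqueness, let \<open>P\<close> be the difference of two such connections. Every \<open>P\<^sub>X\<close> is skew and
  commutes with \<open>\<phi>\<close>, and the torsion condition makes \<open>S(X, Y, Z) = g(P\<^sub>X Y, Z)\<close> totally
  skew on \<open>ker \<eta>\<close>. Moving \<open>\<phi>\<close> from one slot of \<open>S\<close> to another changes the sign, and
  among three slots this forces \<open>S(\<phi> X, Y, Z) = 0\<close>. The condition on \<open>\<tau>\<close> says that \<open>P\<^sub>\<xi>\<close>
  anticommutes with \<open>\<phi>\<close>, so \<open>P\<^sub>\<xi> = 0\<close>.
\<close>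

section \<open>Smooth functions and vector fields\<close>

text \<open>Since \<open>S\<close> is open, functions that agree on \<open>S\<close> agree near each
  of its points and have the same derivatives there. The sum and product rules use this to replace
  \<open>frechet_derivative\<close> by its formula on \<open>S\<close>.\<close>

lemma Ck_on_cong:
  assumes "open S" and "\<And>x. x \<in> S \<Longrightarrow> f x = g x" and "Ck_on k S f"
  shows "Ck_on k S g"
  using assms(2,3)
proof (induction k arbitrary: f g)
  case 0
  then show ?case
    using continuous_on_cong by fastforce
next
  case (Suc k)
  have D: "(g has_derivative frechet_derivative f (at x)) (at x)" if "x \<in> S" for x
    using Suc.prems \<open>open S\<close> that
    by (auto intro: has_derivative_transform_within_open simp: frechet_derivative_works)
  then have "frechet_derivative g (at x) = frechet_derivative f (at x)" if "x \<in> S" for x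
    using that frechet_derivative_at by metis
  then have "Ck_on k S (\<lambda>x. frechet_derivative g (at x) v)" for v
    using Suc.prems(2)
      Suc.IH[of "\<lambda>x. frechet_derivative f (at x) v" "\<lambda>x. frechet_derivative g (at x) v"]
    by simp
  then show ?case
    using D by (auto simp: differentiable_def)
qed

lemma Ck_on_Suc_imp:
  assumes "Ck_on (Suc k) S f"
  shows "Ck_on k S f"
  using assms
proof (induction k arbitrary: f)
  case 0
  then have "\<forall>x\<in>S. f differentiable at x" by simp
  then show ?case
    by (auto intro!: continuous_at_imp_continuous_on differentiable_imp_continuous_within)
next
  case (Suc k)
  from Suc.prems have "\<forall>x\<in>S. f differentiable at x"
    and "Ck_on (Suc k) S (\<lambda>x. frechet_derivative f (at x) v)" for v
    by (metis Ck_on.simps(2))+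
  with Suc.IH show ?case
    by (subst Ck_on.simps) blast
qed

lemma Ck_on_const: "Ck_on k S (\<lambda>x. c)"
  by (induction k arbitrary: c) auto

lemma Ck_on_add:
  assumes "open S" and "Ck_on k S f" and "Ck_on k S g"
  shows "Ck_on k S (\<lambda>x. f x + g x)"
  using assms(2,3)
proof (induction k arbitrary: f g)
  case 0
  then show ?case by (auto intro: continuous_on_add)
next
  case (Suc k)
  have "Ck_on k S (\<lambda>x. frechet_derivative (\<lambda>x. f x + g x) (at x) v)" for v
  proof (rule Ck_on_cong[OF \<open>open S\<close>])
    show "Ck_on k S (\<lambda>x. frechet_derivative f (at x) v + frechet_derivative g (at x) v)"
      using Suc.prems by (intro Suc.IH) simp_all
    show "frechet_derivative f (at x) v + frechet_derivative g (at x) v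
        = frechet_derivative (\<lambda>x. f x + g x) (at x) v" if "x \<in> S" for x
    proof -
      have "((\<lambda>x. f x + g x) has_derivative (\<lambda>v. frechet_derivative f (at x) v
          + frechet_derivative g (at x) v)) (at x)"
        using Suc.prems that by (intro has_derivative_add) (auto simp flip: frechet_derivative_works)
      from frechet_derivative_at[OF this] show ?thesis by metis
    qed
  qed
  then show ?case
    using Suc.prems by (auto intro: differentiable_add)
qed

lemma Ck_on_mult:
  fixes f g :: "'a::euclidean_space \<Rightarrow> real"
  assumes "open S" and "Ck_on k S f" and "Ck_on k S g"
  shows "Ck_on k S (\<lambda>x. f x * g x)"
  using assms(2,3)
proof (induction k arbitrary: f g)
  case 0
  then show ?case by (auto intro: continuous_on_mult)
next
  case (Suc k)
  \<comment> \<open>The Leibniz formula mixes derivatives with the undifferentiated factors, so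
    these are needed at order \<open>k\<close> as well.\<close>
  note lower = Suc.prems[THEN Ck_on_Suc_imp]
  have "Ck_on k S (\<lambda>x. frechet_derivative (\<lambda>x. f x * g x) (at x) v)" for v
  proof (rule Ck_on_cong[OF \<open>open S\<close>])
    show "Ck_on k S (\<lambda>x. f x * frechet_derivative g (at x) v + frechet_derivative f (at x) v * g x)"
      using Suc.prems lower by (intro Ck_on_add[OF \<open>open S\<close>] Suc.IH) simp_all
    show "f x * frechet_derivative g (at x) v + frechet_derivative f (at x) v * g x
        = frechet_derivative (\<lambda>x. f x * g x) (at x) v" if "x \<in> S" for x
    proof -
      have "((\<lambda>x. f x * g x) has_derivative (\<lambda>v. f x * frechet_derivative g (at x) v
          + frechet_derivative f (at x) v * g x)) (at x)"
        using Suc.prems that by (intro has_derivative_mult) (auto simp flip: frechet_derivative_works)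
      from frechet_derivative_at[OF this] show ?thesis by metis
    qed
  qed
  then show ?case
    using Suc.prems by (auto intro: differentiable_mult)
qed

lemma smooth_functions_const: "(\<lambda>p. c) \<in> smooth_functions A"
  by (auto simp: smooth_functions_def smooth_on_def o_def intro: Ck_on_const)

lemma smooth_functions_add:
  assumes "smooth_manifold A" and "f \<in> smooth_functions A" and "k \<in> smooth_functions A"
  shows "(\<lambda>p. f p + k p) \<in> smooth_functions A"
  unfolding smooth_functions_def
proof (safe)
  fix U \<kappa>
  assume U: "(U, \<kappa>) \<in> A"
  then have "open (\<kappa> ` U)"
    using assms(1) by (auto simp: smooth_manifold_def)
  moreover have "smooth_on (\<kappa> ` U) (f \<circ> inv_into U \<kappa>)" "smooth_on (\<kappa> ` U) (k \<circ> inv_into U \<kappa>)"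
    using assms(2,3) U by (auto simp: smooth_functions_def)
  ultimately show "smooth_on (\<kappa> ` U) ((\<lambda>p. f p + k p) \<circ> inv_into U \<kappa>)"
    by (simp add: smooth_on_def o_def Ck_on_add)
qed

lemma smooth_functions_mult:
  assumes "smooth_manifold A" and "f \<in> smooth_functions A" and "k \<in> smooth_functions A"
  shows "(\<lambda>p. f p * k p) \<in> smooth_functions A"
  unfolding smooth_functions_def
proof (safe)
  fix U \<kappa>
  assume U: "(U, \<kappa>) \<in> A"
  then have "open (\<kappa> ` U)"
    using assms(1) by (auto simp: smooth_manifold_def)
  moreover have "smooth_on (\<kappa> ` U) (f \<circ> inv_into U \<kappa>)" "smooth_on (\<kappa> ` U) (k \<circ> inv_into U \<kappa>)"
    using assms(2,3) U by (auto simp: smooth_functions_def)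
  ultimately show "smooth_on (\<kappa> ` U) ((\<lambda>p. f p * k p) \<circ> inv_into U \<kappa>)"
    by (simp add: smooth_on_def o_def Ck_on_mult)
qed

section \<open>Tangent spaces and the module of vector fields\<close>

lemma tangent_space_add:
  assumes "v \<in> tangent_space A p" and "w \<in> tangent_space A p"
  shows "v + w \<in> tangent_space A p"
  using assms by (simp add: tangent_space_def algebra_simps)

lemma tangent_space_scale:
  assumes "v \<in> tangent_space A p"
  shows "(\<lambda>f. c * v f) \<in> tangent_space A p"
  using assms by (simp add: tangent_space_def algebra_simps)

lemma vector_fields_add:
  assumes "smooth_manifold A" and "X \<in> vector_fields A" and "Y \<in> vector_fields A"
  shows "X + Y \<in> vector_fields A"
  using assms smooth_functions_add[OF assms(1)]
  by (simp add: vector_fields_def tangent_space_add deriv_along_def)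

lemma vector_fields_scale:
  assumes "smooth_manifold A" and "f \<in> smooth_functions A" and "X \<in> vector_fields A"
  shows "f \<odot> X \<in> vector_fields A"
  using assms smooth_functions_mult[OF assms(1)]
  by (simp add: vector_fields_def tangent_space_scale deriv_along_def fscale_def)

lemma vector_fields_in_tangent_space: "X \<in> vector_fields A \<Longrightarrow> X p \<in> tangent_space A p"
  by (simp add: vector_fields_def)

lemma vector_fields_uminus:
  assumes "smooth_manifold A" and "X \<in> vector_fields A"
  shows "- X \<in> vector_fields A"
proof -
  have "- X = (\<lambda>p. -1) \<odot> X"
    by (simp add: fscale_def fun_eq_iff)
  with assms show ?thesis
    by (simp add: vector_fields_scale smooth_functions_const)
qed

lemma vector_fields_minus:
  assumes "smooth_manifold A" and "X \<in> vector_fields A" and "Y \<in> vector_fields A"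
  shows "X - Y \<in> vector_fields A"
  using vector_fields_add[OF assms(1,2) vector_fields_uminus[OF assms(1,3)]] by simp

lemma deriv_along_uminus:
  assumes "X \<in> vector_fields A" and "f \<in> smooth_functions A"
  shows "deriv_along X (\<lambda>p. - f p) = (\<lambda>p. - deriv_along X f p)"
proof
  fix p
  have "X p \<in> tangent_space A p"
    using assms(1) by (rule vector_fields_in_tangent_space)
  then have "X p (\<lambda>q. -1 * f q) = -1 * X p f"
    using assms(2) unfolding tangent_space_def by blast
  then show "deriv_along X (\<lambda>p. - f p) p = - deriv_along X f p"
    by (simp add: deriv_along_def)
qed

lemma fscale_apply: "(a \<odot> X) p k = a p * X p k"
  by (simp add: fscale_def)

lemma fscale_zero: "a \<odot> (0 :: 'm vfield) = 0"
  by (simp add: fscale_def fun_eq_iff)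

section \<open>Linear connections and almost contact metric structures\<close>

locale connection_on_manifold =
  fixes A :: "('m::{t2_space, second_countable_topology}, 'e::euclidean_space) atlas"
    and D :: "'m conn"
  assumes manifold: "smooth_manifold A"
    and connection: "linear_connection A D"
begin

lemma closed [simp]:
  "X \<in> vector_fields A \<Longrightarrow> Y \<in> vector_fields A \<Longrightarrow> D X Y \<in> vector_fields A"
  using connection by (auto simp: linear_connection_def PiE_iff)

lemma add_left:
  "X \<in> vector_fields A \<Longrightarrow> X' \<in> vector_fields A \<Longrightarrow> Y \<in> vector_fields A \<Longrightarrow>
    D (X + X') Y = D X Y + D X' Y"
  using connection by (auto simp: linear_connection_def)

lemma scale_left:
  "f \<in> smooth_functions A \<Longrightarrow> X \<in> vector_fields A \<Longrightarrow> Y \<in> vector_fields A \<Longrightarrow>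
    D (f \<odot> X) Y = f \<odot> D X Y"
  using connection by (auto simp: linear_connection_def)

lemma add_right:
  "X \<in> vector_fields A \<Longrightarrow> Y \<in> vector_fields A \<Longrightarrow> Y' \<in> vector_fields A \<Longrightarrow>
    D X (Y + Y') = D X Y + D X Y'"
  using connection by (auto simp: linear_connection_def)

lemma scale_right:
  "f \<in> smooth_functions A \<Longrightarrow> X \<in> vector_fields A \<Longrightarrow> Y \<in> vector_fields A \<Longrightarrow>
    D X (f \<odot> Y) = deriv_along X f \<odot> Y + f \<odot> D X Y"
  using connection by (auto simp: linear_connection_def)

lemma minus_right:
  assumes "X \<in> vector_fields A" and "Y \<in> vector_fields A" and "Y' \<in> vector_fields A"
  shows "D X (Y - Y') = D X Y - D X Y'"
  using assms manifold add_right[of X "Y - Y'" Y'] by (simp add: vector_fields_minus)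

lemma zero_right: "X \<in> vector_fields A \<Longrightarrow> D X 0 = 0"
  using minus_right[of X X X] by simp

end

locale almost_contact_metric_manifold =
  fixes A :: "('m::{t2_space, second_countable_topology}, 'e::euclidean_space) atlas"
    and \<phi> :: "'m \<Rightarrow> 'm tvec \<Rightarrow> 'm tvec"
    and \<xi> :: "'m vfield"
    and \<eta> :: "'m \<Rightarrow> 'm tvec \<Rightarrow> real"
    and g :: "'m \<Rightarrow> 'm tvec \<Rightarrow> 'm tvec \<Rightarrow> real"
  assumes manifold: "smooth_manifold A"
    and acm: "almost_contact_metric A \<phi> \<xi> \<eta> g"
begin

section \<open>Linearity and symmetry of the structure tensors on vector fields\<close>

abbreviation "\<XX> \<equiv> vector_fields A"
abbreviation "\<C> \<equiv> smooth_functions A"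
abbreviation "G \<equiv> ev2 g"

lemma endo: "endo_field A \<phi>" and form: "one_form A \<eta>" and metric: "riemannian_metric A g"
  and xi [simp]: "\<xi> \<in> \<XX>"
  using acm by (auto simp: almost_contact_metric_def)

lemma smooth_closure [simp]:
  "(\<lambda>p. c) \<in> \<C>"
  "a \<in> \<C> \<Longrightarrow> b \<in> \<C> \<Longrightarrow> (\<lambda>p. a p + b p) \<in> \<C>"
  "a \<in> \<C> \<Longrightarrow> b \<in> \<C> \<Longrightarrow> (\<lambda>p. a p * b p) \<in> \<C>"
  "X \<in> \<XX> \<Longrightarrow> a \<in> \<C> \<Longrightarrow> deriv_along X a \<in> \<C>"
  using manifold
  by (auto simp: smooth_functions_const smooth_functions_add smooth_functions_mult vector_fields_def)

lemma smooth_closure_derived [simp]: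
  "0 \<in> \<C>"
  "a \<in> \<C> \<Longrightarrow> (\<lambda>p. - a p) \<in> \<C>"
  "a \<in> \<C> \<Longrightarrow> (\<lambda>p. a p / c) \<in> \<C>"
  using smooth_closure(1)[of 0] smooth_closure(3)[OF smooth_closure(1)[of "-1"], of a]
    smooth_closure(3)[OF smooth_closure(1)[of "1 / c"], of a]
  by (simp_all add: func_zero)

lemma vf_closure [simp]:
  "X \<in> \<XX> \<Longrightarrow> Y \<in> \<XX> \<Longrightarrow> X + Y \<in> \<XX>"
  "X \<in> \<XX> \<Longrightarrow> Y \<in> \<XX> \<Longrightarrow> X - Y \<in> \<XX>"
  "X \<in> \<XX> \<Longrightarrow> - X \<in> \<XX>"
  "a \<in> \<C> \<Longrightarrow> X \<in> \<XX> \<Longrightarrow> a \<odot> X \<in> \<XX>"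
  using manifold
  by (auto simp: vector_fields_add vector_fields_minus vector_fields_uminus vector_fields_scale)

lemma phi_vf [simp]: "X \<in> \<XX> \<Longrightarrow> \<phi> \<triangleright> X \<in> \<XX>"
  using endo by (simp add: endo_field_def)

lemma tensor_smooth [simp]:
  "X \<in> \<XX> \<Longrightarrow> \<eta> \<triangleright> X \<in> \<C>"
  "X \<in> \<XX> \<Longrightarrow> Y \<in> \<XX> \<Longrightarrow> G X Y \<in> \<C>"
  using form metric by (auto simp: one_form_def riemannian_metric_def)

lemma eta_linear:
  "X \<in> \<XX> \<Longrightarrow> Y \<in> \<XX> \<Longrightarrow> (\<eta> \<triangleright> (X + Y)) p = (\<eta> \<triangleright> X) p + (\<eta> \<triangleright> Y) p"
  "X \<in> \<XX> \<Longrightarrow> (\<eta> \<triangleright> (a \<odot> X)) p = a p * (\<eta> \<triangleright> X) p"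
  using form vector_fields_in_tangent_space[of _ A p]
  by (auto simp: one_form_def ev_def fscale_def)

lemma phi_linear:
  "X \<in> \<XX> \<Longrightarrow> Y \<in> \<XX> \<Longrightarrow> \<phi> \<triangleright> (X + Y) = \<phi> \<triangleright> X + \<phi> \<triangleright> Y"
  "X \<in> \<XX> \<Longrightarrow> \<phi> \<triangleright> (a \<odot> X) = a \<odot> \<phi> \<triangleright> X"
  using endo vector_fields_in_tangent_space[of _ A]
  by (auto simp: endo_field_def ev_def fscale_def fun_eq_iff)

lemma G_commute: "X \<in> \<XX> \<Longrightarrow> Y \<in> \<XX> \<Longrightarrow> G X Y p = G Y X p"
  using metric vector_fields_in_tangent_space[of _ A p]
  by (auto simp: riemannian_metric_def ev2_def)

lemma G_linear_left:
  "X \<in> \<XX> \<Longrightarrow> Y \<in> \<XX> \<Longrightarrow> Z \<in> \<XX> \<Longrightarrow> G (X + Y) Z p = G X Z p + G Y Z p"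
  "X \<in> \<XX> \<Longrightarrow> Z \<in> \<XX> \<Longrightarrow> G (a \<odot> X) Z p = a p * G X Z p"
  using metric vector_fields_in_tangent_space[of _ A p]
  by (auto simp: riemannian_metric_def ev2_def fscale_def)

lemma uminus_as_scale: "- (X :: 'm vfield) = (\<lambda>p. -1) \<odot> X"
  by (simp add: fscale_def fun_eq_iff)

lemma minus_as_scale: "(X :: 'm vfield) - Y = X + (\<lambda>p. -1) \<odot> Y"
  by (simp add: fscale_def fun_eq_iff)

lemma eta_simps [simp]:
  "X \<in> \<XX> \<Longrightarrow> Y \<in> \<XX> \<Longrightarrow> (\<eta> \<triangleright> (X + Y)) p = (\<eta> \<triangleright> X) p + (\<eta> \<triangleright> Y) p"
  "X \<in> \<XX> \<Longrightarrow> Y \<in> \<XX> \<Longrightarrow> (\<eta> \<triangleright> (X - Y)) p = (\<eta> \<triangleright> X) p - (\<eta> \<triangleright> Y) p"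
  "X \<in> \<XX> \<Longrightarrow> (\<eta> \<triangleright> (- X)) p = - (\<eta> \<triangleright> X) p"
  "X \<in> \<XX> \<Longrightarrow> (\<eta> \<triangleright> (a \<odot> X)) p = a p * (\<eta> \<triangleright> X) p"
  by (simp_all add: eta_linear uminus_as_scale[of X] minus_as_scale)

lemma phi_simps [simp]:
  "X \<in> \<XX> \<Longrightarrow> Y \<in> \<XX> \<Longrightarrow> \<phi> \<triangleright> (X + Y) = \<phi> \<triangleright> X + \<phi> \<triangleright> Y"
  "X \<in> \<XX> \<Longrightarrow> Y \<in> \<XX> \<Longrightarrow> \<phi> \<triangleright> (X - Y) = \<phi> \<triangleright> X - \<phi> \<triangleright> Y"
  "X \<in> \<XX> \<Longrightarrow> \<phi> \<triangleright> (- X) = - (\<phi> \<triangleright> X)"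
  "X \<in> \<XX> \<Longrightarrow> \<phi> \<triangleright> (a \<odot> X) = a \<odot> \<phi> \<triangleright> X"
  by (simp_all add: phi_linear uminus_as_scale[of X] uminus_as_scale[of "\<phi> \<triangleright> X"] minus_as_scale)

lemma G_simps [simp]:
  "X \<in> \<XX> \<Longrightarrow> Y \<in> \<XX> \<Longrightarrow> Z \<in> \<XX> \<Longrightarrow> G (X + Y) Z p = G X Z p + G Y Z p"
  "X \<in> \<XX> \<Longrightarrow> Y \<in> \<XX> \<Longrightarrow> Z \<in> \<XX> \<Longrightarrow> G (X - Y) Z p = G X Z p - G Y Z p"
  "X \<in> \<XX> \<Longrightarrow> Z \<in> \<XX> \<Longrightarrow> G (- X) Z p = - G X Z p"
  "X \<in> \<XX> \<Longrightarrow> Z \<in> \<XX> \<Longrightarrow> G (a \<odot> X) Z p = a p * G X Z p"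
  by (simp_all add: G_linear_left uminus_as_scale[of X] minus_as_scale)

lemma G_simps_right [simp]:
  "X \<in> \<XX> \<Longrightarrow> Y \<in> \<XX> \<Longrightarrow> Z \<in> \<XX> \<Longrightarrow> G Z (X + Y) p = G Z X p + G Z Y p"
  "X \<in> \<XX> \<Longrightarrow> Y \<in> \<XX> \<Longrightarrow> Z \<in> \<XX> \<Longrightarrow> G Z (X - Y) p = G Z X p - G Z Y p"
  "X \<in> \<XX> \<Longrightarrow> Z \<in> \<XX> \<Longrightarrow> G Z (- X) p = - G Z X p"
  "a \<in> \<C> \<Longrightarrow> X \<in> \<XX> \<Longrightarrow> Z \<in> \<XX> \<Longrightarrow> G Z (a \<odot> X) p = a p * G Z X p"
  by (simp_all add: G_commute[of Z])

lemma zero_vf [simp]: "0 \<in> \<XX>"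
  using vf_closure(2)[OF xi xi] by simp

lemma zero_simps [simp]:
  "\<phi> \<triangleright> 0 = 0"
  "(\<eta> \<triangleright> 0) p = 0"
  "Z \<in> \<XX> \<Longrightarrow> G 0 Z p = 0"
  "Z \<in> \<XX> \<Longrightarrow> G Z 0 p = 0"
  using phi_simps(2)[OF xi xi] eta_simps(2)[OF xi xi, of p] G_simps(2)[OF xi xi, of Z p]
    G_simps_right(2)[OF xi xi, of Z p]
  by simp_all

text \<open>Testing against the smooth field \<open>X - Y\<close> itself shows that its norm
  vanishes at every point, and \<open>g\<close> is definite.\<close>

lemma vf_eqI:
  assumes [simp]: "X \<in> \<XX>" "Y \<in> \<XX>" and eq: "\<And>Z p. Z \<in> \<XX> \<Longrightarrow> G X Z p = G Y Z p"
  shows "X = Y"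
proof
  fix p
  have "G (X - Y) (X - Y) p = 0"
    using eq[of "X - Y" p] by simp
  then have "\<not> g p ((X - Y) p) ((X - Y) p) > 0"
    by (simp add: ev2_def)
  moreover have "(X - Y) p \<in> tangent_space A p"
    by (rule vector_fields_in_tangent_space[of "X - Y"]) simp
  ultimately have "(X - Y) p = 0"
    using metric unfolding riemannian_metric_def by blast
  then show "X p = Y p"
    by simp
qed

section \<open>Algebraic identities of an almost contact metric structure\<close>

lemma phi_phi: "X \<in> \<XX> \<Longrightarrow> \<phi> \<triangleright> \<phi> \<triangleright> X = (\<eta> \<triangleright> X) \<odot> \<xi> - X"
  using acm vector_fields_in_tangent_space[of X A]
  by (auto simp: almost_contact_metric_def ev_def fscale_def fun_eq_iff)

lemma eta_xi [simp]: "(\<eta> \<triangleright> \<xi>) p = 1"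
  using acm by (simp add: almost_contact_metric_def ev_def)

text \<open>From \<open>\<phi> \<triangleright> \<phi> \<triangleright> \<xi> = 0\<close> follows
  \<phi>\<xi> = f\<xi> with f = \<eta>(\<phi>\<xi>). Applying \<phi> and then \<eta> yields f * f =
  0.\<close>

lemma phi_xi [simp]: "\<phi> \<triangleright> \<xi> = 0"
proof -
  have "\<phi> \<triangleright> \<phi> \<triangleright> \<xi> = 0"
    by (subst phi_phi) (simp_all add: fscale_def fun_eq_iff)
  then have *: "\<phi> \<triangleright> \<xi> = (\<eta> \<triangleright> \<phi> \<triangleright> \<xi>) \<odot> \<xi>"
    using phi_phi[of "\<phi> \<triangleright> \<xi>"] by simp
  then have "(\<eta> \<triangleright> \<phi> \<triangleright> \<xi>) \<odot> \<phi> \<triangleright> \<xi> = 0"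
    using \<open>\<phi> \<triangleright> \<phi> \<triangleright> \<xi> = 0\<close> phi_simps(4)[OF xi, of "\<eta> \<triangleright> \<phi> \<triangleright> \<xi>"] by simp
  then have "(\<eta> \<triangleright> \<phi> \<triangleright> \<xi>) p * (\<eta> \<triangleright> \<phi> \<triangleright> \<xi>) p = 0" for p
    using eta_simps(4)[OF phi_vf[OF xi], of "\<eta> \<triangleright> \<phi> \<triangleright> \<xi>" p] by simp
  then have "(\<eta> \<triangleright> \<phi> \<triangleright> \<xi>) p = 0" for p
    by simp
  then show ?thesis
    using * by (simp add: fscale_def fun_eq_iff)
qed

text \<open>The third power of \<phi> at \<open>X\<close> is computed in two ways, grouping the
  inner or the outer two factors; the results differ by \<eta>(\<phi>X)\<xi>.\<close>

lemma eta_phi [simp]: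
  assumes [simp]: "X \<in> \<XX>"
  shows "(\<eta> \<triangleright> \<phi> \<triangleright> X) p = 0"
proof -
  have "\<phi> \<triangleright> \<phi> \<triangleright> \<phi> \<triangleright> X = - (\<phi> \<triangleright> X)"
    using arg_cong[OF phi_phi[of X], of "\<lambda>Y. \<phi> \<triangleright> Y"] by (simp add: fscale_zero)
  then have "(\<eta> \<triangleright> \<phi> \<triangleright> X) \<odot> \<xi> = 0"
    using phi_phi[of "\<phi> \<triangleright> X"] by simp
  then have "(\<eta> \<triangleright> ((\<eta> \<triangleright> \<phi> \<triangleright> X) \<odot> \<xi>)) p = (\<eta> \<triangleright> 0) p"
    by (rule arg_cong)
  then show ?thesis
    by simp
qed

lemma G_phi_phi:
  "X \<in> \<XX> \<Longrightarrow> Y \<in> \<XX> \<Longrightarrow> G (\<phi> \<triangleright> X) (\<phi> \<triangleright> Y) p = G X Y p - (\<eta> \<triangleright> X) p * (\<eta> \<triangleright> Y) p"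
  using acm vector_fields_in_tangent_space[of _ A p]
  by (auto simp: almost_contact_metric_def ev_def ev2_def)

lemma G_xi [simp]:
  assumes [simp]: "X \<in> \<XX>"
  shows "G X \<xi> p = (\<eta> \<triangleright> X) p" "G \<xi> X p = (\<eta> \<triangleright> X) p"
  using G_phi_phi[of X \<xi> p] G_commute[of X \<xi> p] by simp_all

text \<open>Compatibility is applied to \<open>\<phi> \<triangleright> X\<close> and
  \<open>Y\<close>; the \<xi>-part of
  \<open>\<phi> \<triangleright> \<phi> \<triangleright> X\<close> is orthogonal to
  \<open>\<phi> \<triangleright> Y\<close>.\<close>

lemma G_phi_right:
  assumes [simp]: "X \<in> \<XX>" "Y \<in> \<XX>"
  shows "G X (\<phi> \<triangleright> Y) p = - G (\<phi> \<triangleright> X) Y p"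
  using G_phi_phi[of "\<phi> \<triangleright> X" Y p] by (simp add: phi_phi)

text \<open>By \<open>phi_phi\<close> a field is recovered from its images under \<phi> and \<eta>.
  Identities between fields killed by \<eta> may therefore be checked after applying \<phi>.\<close>

lemma phi_eta_eq_0:
  assumes [simp]: "X \<in> \<XX>" and "\<phi> \<triangleright> X = 0" and "\<And>p. (\<eta> \<triangleright> X) p = 0"
  shows "X = 0"
  using phi_phi[of X] assms by (simp add: fscale_def fun_eq_iff)

end

section \<open>The canonical connection of a nearly Sasakian manifold\<close>

locale nearly_sasakian_manifold =
  fixes A :: "('m::{t2_space, second_countable_topology}, 'e::euclidean_space) atlas"
    and \<phi> :: "'m \<Rightarrow> 'm tvec \<Rightarrow> 'm tvec"
    and \<xi> :: "'m vfield"
    and \<eta> :: "'m \<Rightarrow> 'm tvec \<Rightarrow> real"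
    and g :: "'m \<Rightarrow> 'm tvec \<Rightarrow> 'm tvec \<Rightarrow> real"
    and nabla :: "'m conn"
  assumes nearly_sasakian: "nearly_sasakian A \<phi> \<xi> \<eta> g nabla"
    and smooth_manifold: "smooth_manifold A"

sublocale nearly_sasakian_manifold \<subseteq> almost_contact_metric_manifold A \<phi> \<xi> \<eta> g
  using nearly_sasakian smooth_manifold by unfold_locales (auto simp: nearly_sasakian_def)

sublocale nearly_sasakian_manifold \<subseteq> nabla: connection_on_manifold A nabla
  using nearly_sasakian smooth_manifold
  by unfold_locales (auto simp: nearly_sasakian_def levi_civita_def)

context nearly_sasakian_manifold
begin

section \<open>Covariant derivatives of \<phi>, \<xi> and \<eta>\<close>

abbreviation "\<Psi> \<equiv> cov_endo nabla \<phi>"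
abbreviation "N X \<equiv> nabla X \<xi>"

lemma torsion_free: "X \<in> \<XX> \<Longrightarrow> Y \<in> \<XX> \<Longrightarrow> torsion nabla X Y = 0"
  using nearly_sasakian by (simp add: nearly_sasakian_def levi_civita_def)

lemma deriv_metric:
  assumes "X \<in> \<XX>" "Y \<in> \<XX>" "Z \<in> \<XX>"
  shows "deriv_along X (G Y Z) p = G (nabla X Y) Z p + G Y (nabla X Z) p"
proof -
  have "cov_metric nabla g X Y Z p = 0"
    using nearly_sasakian assms by (simp add: nearly_sasakian_def levi_civita_def)
  then show ?thesis
    by (simp add: cov_metric_def)
qed

lemma Psi_closed [simp]: "X \<in> \<XX> \<Longrightarrow> Y \<in> \<XX> \<Longrightarrow> \<Psi> X Y \<in> \<XX>"
  by (simp add: cov_endo_def)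

text \<open>The defining identity, solved for one of its terms so that it serves to exchange the two
  arguments of \<open>\<Psi>\<close>.\<close>

lemma Psi_nearly:
  "X \<in> \<XX> \<Longrightarrow> Y \<in> \<XX> \<Longrightarrow>
    \<Psi> Y X = (\<lambda>p. 2 * G X Y p) \<odot> \<xi> - (\<eta> \<triangleright> X) \<odot> Y - (\<eta> \<triangleright> Y) \<odot> X - \<Psi> X Y"
  using nearly_sasakian unfolding nearly_sasakian_def by (simp add: eq_diff_eq add.commute)

lemma Psi_add_left:
  "X \<in> \<XX> \<Longrightarrow> X' \<in> \<XX> \<Longrightarrow> Y \<in> \<XX> \<Longrightarrow> \<Psi> (X + X') Y = \<Psi> X Y + \<Psi> X' Y"
  by (simp add: cov_endo_def nabla.add_left)

lemma Psi_add_right: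
  "X \<in> \<XX> \<Longrightarrow> Y \<in> \<XX> \<Longrightarrow> Y' \<in> \<XX> \<Longrightarrow> \<Psi> X (Y + Y') = \<Psi> X Y + \<Psi> X Y'"
  by (simp add: cov_endo_def nabla.add_right)

lemma Psi_minus_right:
  "X \<in> \<XX> \<Longrightarrow> Y \<in> \<XX> \<Longrightarrow> Y' \<in> \<XX> \<Longrightarrow> \<Psi> X (Y - Y') = \<Psi> X Y - \<Psi> X Y'"
  by (simp add: cov_endo_def nabla.minus_right)

lemma Psi_scale_left:
  "f \<in> \<C> \<Longrightarrow> X \<in> \<XX> \<Longrightarrow> Y \<in> \<XX> \<Longrightarrow> \<Psi> (f \<odot> X) Y = f \<odot> \<Psi> X Y"
  by (simp add: cov_endo_def nabla.scale_left) (simp add: fscale_apply fun_eq_iff algebra_simps)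

lemma Psi_scale_right:
  "f \<in> \<C> \<Longrightarrow> X \<in> \<XX> \<Longrightarrow> Y \<in> \<XX> \<Longrightarrow> \<Psi> X (f \<odot> Y) = f \<odot> \<Psi> X Y"
  by (simp add: cov_endo_def nabla.scale_right) (simp add: fscale_apply fun_eq_iff algebra_simps)

text \<open>Differentiate g(Y, \<phi>Z) = - g(\<phi>Y, Z) along \<open>X\<close> with the metric
  connection \<open>nabla\<close>.\<close>

lemma Psi_skew:
  assumes [simp]: "X \<in> \<XX>" "Y \<in> \<XX>" "Z \<in> \<XX>"
  shows "G (\<Psi> X Y) Z p = - G Y (\<Psi> X Z) p"
proof -
  have "G Y (\<phi> \<triangleright> Z) = (\<lambda>p. - G (\<phi> \<triangleright> Y) Z p)"
    by (simp add: fun_eq_iff G_phi_right)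
  then have "deriv_along X (G Y (\<phi> \<triangleright> Z)) p = - deriv_along X (G (\<phi> \<triangleright> Y) Z) p"
    by (simp add: deriv_along_uminus[of X A])
  then show ?thesis
    by (simp add: deriv_metric cov_endo_def G_phi_right algebra_simps)
qed

lemma Psi_xi:
  assumes [simp]: "X \<in> \<XX>"
  shows "\<Psi> X \<xi> = - (\<phi> \<triangleright> N X)"
proof -
  show ?thesis
    by (simp add: cov_endo_def nabla.zero_right)
qed

text \<open>The field \<xi> has constant length 1 and \<open>nabla\<close> is metric.\<close>

lemma eta_N [simp]:
  assumes [simp]: "X \<in> \<XX>"
  shows "(\<eta> \<triangleright> N X) p = 0"
proof -
  have "G \<xi> \<xi> = (\<lambda>p. 1)"
    by (simp add: fun_eq_iff)
  moreover have "deriv_along X (\<lambda>p. 1) p = 0"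
  proof -
    have "X p \<in> tangent_space A p"
      by (rule vector_fields_in_tangent_space) simp
    then have "X p (\<lambda>q. a q * b q) = a p * X p b + b p * X p a" if "a \<in> \<C>" "b \<in> \<C>" for a b
      using that unfolding tangent_space_def by blast
    \<comment> \<open>The Leibniz rule for 1 = 1 * 1 makes the derivative of 1 equal to twice
      itself.\<close>
    from this[of "\<lambda>q. 1" "\<lambda>q. 1"] show ?thesis
      by (simp add: deriv_along_def)
  qed
  ultimately show ?thesis
    using deriv_metric[of X \<xi> \<xi> p] by simp
qed

text \<open>The form \<eta> is the metric dual of \<xi>, so its covariant derivative is dual to
  \<open>N X\<close>.\<close>

lemma deriv_eta:
  assumes [simp]: "X \<in> \<XX>" "Y \<in> \<XX>"
  shows "deriv_along X (\<eta> \<triangleright> Y) p = (\<eta> \<triangleright> nabla X Y) p + G Y (N X) p"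
proof -
  have "\<eta> \<triangleright> Y = G Y \<xi>"
    by (simp add: fun_eq_iff)
  then show ?thesis
    by (simp add: deriv_metric)
qed

text \<open>Covariant derivative of \<open>\<phi>\<^sup>2 = - I + \<eta> \<otimes> \<xi>\<close>.\<close>

lemma Psi_phi:
  assumes [simp]: "X \<in> \<XX>" "Y \<in> \<XX>"
  shows "\<Psi> X (\<phi> \<triangleright> Y) = G Y (N X) \<odot> \<xi> + (\<eta> \<triangleright> Y) \<odot> N X - \<phi> \<triangleright> \<Psi> X Y"
proof -
  \<comment> \<open>The two middle terms
    \<open>\<phi> \<triangleright> nabla X (\<phi> \<triangleright> Y)\<close> cancel.\<close>
  have "\<Psi> X (\<phi> \<triangleright> Y) + \<phi> \<triangleright> \<Psi> X Y = nabla X (\<phi> \<triangleright> \<phi> \<triangleright> Y) - \<phi> \<triangleright> \<phi> \<triangleright> nabla X Y"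
    by (simp add: cov_endo_def)
  also have "\<dots> = G Y (N X) \<odot> \<xi> + (\<eta> \<triangleright> Y) \<odot> N X"
    by (simp add: phi_phi nabla.minus_right nabla.scale_right)
      (simp add: fun_eq_iff fscale_apply deriv_eta algebra_simps)
  finally show ?thesis
    by (simp add: eq_diff_eq)
qed

text \<open>For both arguments equal to \<xi> the right-hand side of the nearly Sasakian identity
  vanishes, so \<open>\<Psi> \<xi> \<xi> = 0\<close>. Thus \<xi> is geodesic.\<close>

lemma N_xi [simp]: "N \<xi> = 0"
proof (rule phi_eta_eq_0)
  have "\<Psi> \<xi> \<xi> = (\<lambda>p. 1) \<odot> \<xi> - \<Psi> \<xi> \<xi> - \<xi>"
    using Psi_nearly[of \<xi> \<xi>] by (simp add: fscale_apply fun_eq_iff)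
  then have "\<Psi> \<xi> \<xi> = 0"
    by (simp add: fscale_apply fun_eq_iff)
  then show "\<phi> \<triangleright> N \<xi> = 0"
    by (simp add: Psi_xi)
qed simp_all

text \<open>The nearly Sasakian identity for \<open>X\<close> and \<xi>, with \<open>Psi_xi\<close>
  for the other term. The bracket on the right is \<open>h X\<close>.\<close>

lemma Psi_xi_left:
  assumes [simp]: "X \<in> \<XX>"
  shows "\<Psi> \<xi> X = \<phi> \<triangleright> (\<phi> \<triangleright> X + N X)"
  by (simp add: Psi_nearly[of X \<xi>] Psi_xi phi_phi) (simp add: fscale_apply fun_eq_iff)

text \<open>In terms of \<open>h = N + \<phi>\<close> this says that \<open>h\<close> anticommutes with \<open>\<phi>\<close>.\<close>

lemma N_phi:
  assumes [simp]: "X \<in> \<XX>"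
  shows "N (\<phi> \<triangleright> X) + \<phi> \<triangleright> N X = (\<lambda>p. - 2) \<odot> \<phi> \<triangleright> \<phi> \<triangleright> X"
proof -
  let ?V = "N (\<phi> \<triangleright> X) + \<phi> \<triangleright> N X + (\<lambda>p. 2) \<odot> \<phi> \<triangleright> \<phi> \<triangleright> X"
  have "?V = 0"
  proof (rule phi_eta_eq_0)
    have "\<phi> \<triangleright> ?V = \<Psi> \<xi> (\<phi> \<triangleright> X) + \<phi> \<triangleright> \<Psi> \<xi> X"
      by (simp add: Psi_xi_left) (simp add: fscale_apply fun_eq_iff)
    \<comment> \<open>In \<open>Psi_phi\<close> along \<xi> the first two terms on the right contain
      \<open>N \<xi>\<close>, which is 0.\<close>
    also have "\<dots> = 0"
      by (simp add: Psi_phi fscale_zero) (simp add: fscale_apply fun_eq_iff)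
    finally show "\<phi> \<triangleright> ?V = 0" .
  qed simp_all
  then have "N (\<phi> \<triangleright> X) + \<phi> \<triangleright> N X = - ((\<lambda>p. 2) \<odot> \<phi> \<triangleright> \<phi> \<triangleright> X)"
    by (simp only: eq_neg_iff_add_eq_0)
  then show ?thesis
    by (simp add: fscale_apply fun_eq_iff)
qed

section \<open>The tensor \<open>K\<close> and the connection it defines\<close>

text \<open>
  The tensor \<open>H\<close> of the theorem, with \<open>\<phi> - h\<close> written as \<open>- N\<close>.
\<close>

definition K :: "real \<Rightarrow> 'm vfield \<Rightarrow> 'm vfield \<Rightarrow> 'm vfield" where
  "K r X Y = (\<lambda>p. 1/2) \<odot> \<Psi> X (\<phi> \<triangleright> Y) - (\<lambda>p. r * (\<eta> \<triangleright> X) p) \<odot> \<phi> \<triangleright> Y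
    - (\<eta> \<triangleright> Y) \<odot> N X + (\<lambda>p. 1/2 * G (N X) Y p) \<odot> \<xi>"

lemma K_closed [simp]: "X \<in> \<XX> \<Longrightarrow> Y \<in> \<XX> \<Longrightarrow> K r X Y \<in> \<XX>"
  by (simp add: K_def)

lemma K_add_left:
  "X \<in> \<XX> \<Longrightarrow> X' \<in> \<XX> \<Longrightarrow> Y \<in> \<XX> \<Longrightarrow> K r (X + X') Y = K r X Y + K r X' Y"
  by (simp add: K_def Psi_add_left nabla.add_left)
    (simp add: fscale_apply fun_eq_iff algebra_simps add_divide_distrib)

lemma K_scale_left:
  "f \<in> \<C> \<Longrightarrow> X \<in> \<XX> \<Longrightarrow> Y \<in> \<XX> \<Longrightarrow> K r (f \<odot> X) Y = f \<odot> K r X Y"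
  by (simp add: K_def Psi_scale_left nabla.scale_left)
    (simp add: fscale_apply fun_eq_iff algebra_simps)

lemma K_add_right:
  "X \<in> \<XX> \<Longrightarrow> Y \<in> \<XX> \<Longrightarrow> Y' \<in> \<XX> \<Longrightarrow> K r X (Y + Y') = K r X Y + K r X Y'"
  by (simp add: K_def Psi_add_right)
    (simp add: fscale_apply fun_eq_iff algebra_simps add_divide_distrib)

lemma K_scale_right:
  "f \<in> \<C> \<Longrightarrow> X \<in> \<XX> \<Longrightarrow> Y \<in> \<XX> \<Longrightarrow> K r X (f \<odot> Y) = f \<odot> K r X Y"
  by (simp add: K_def Psi_scale_right fscale_apply fun_eq_iff algebra_simps)

text \<open>The terms with \<phi>\<xi> vanish and \<open>N X\<close> is orthogonal to \<xi>. The
  remaining term cancels \<open>nabla X \<xi>\<close>, so \<xi> becomes parallel.\<close>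

lemma K_xi_right:
  "X \<in> \<XX> \<Longrightarrow> K r X \<xi> = - N X"
  by (simp add: K_def cov_endo_def nabla.zero_right fscale_zero)
    (simp add: fscale_apply fun_eq_iff)

text \<open>This is metricity of \<open>nabla + K\<close>. By \<open>Psi_phi\<close> the first term
  of \<open>K\<close> fails to be skew only by products of \<eta> with \<open>N X\<close>, which the
  last two terms cancel; the term with \<open>r\<close> is skew because \<phi> is.\<close>

lemma K_skew:
  assumes [simp]: "X \<in> \<XX>" "Y \<in> \<XX>" "Z \<in> \<XX>"
  shows "G (K r X Y) Z p + G Y (K r X Z) p = 0"
proof -
  have "G Y (\<Psi> X (\<phi> \<triangleright> Z)) p = G (\<phi> \<triangleright> \<Psi> X Y) Z p"
    using Psi_skew[of X Y "\<phi> \<triangleright> Z" p] G_phi_right[of "\<Psi> X Y" Z p] by simp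
  moreover have "G Y (\<phi> \<triangleright> Z) p = - G (\<phi> \<triangleright> Y) Z p"
    by (simp add: G_phi_right)
  moreover have "G Y (N X) p = G (N X) Y p"
    by (simp add: G_commute)
  ultimately show ?thesis
    by (simp add: K_def Psi_phi field_simps)
qed

text \<open>The left-hand side is the derivative of \<phi> under \<open>nabla + K\<close>. By
  \<open>Psi_phi\<close> both terms with \<open>K\<close> contribute minus one half of
  \<open>\<Psi> X Y\<close>, which explains the coefficient 1/2; the remaining terms cancel.\<close>

lemma K_phi:
  assumes [simp]: "X \<in> \<XX>" "Y \<in> \<XX>"
  shows "\<Psi> X Y + K r X (\<phi> \<triangleright> Y) - \<phi> \<triangleright> K r X Y = 0"
proof -
  have 1: "\<Psi> X (\<phi> \<triangleright> \<phi> \<triangleright> Y) = - \<Psi> X Y - (\<eta> \<triangleright> Y) \<odot> \<phi> \<triangleright> N X"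
    by (simp add: phi_phi Psi_minus_right Psi_scale_right Psi_xi) (simp add: fscale_apply fun_eq_iff)
  have 2: "\<phi> \<triangleright> \<Psi> X (\<phi> \<triangleright> Y) = G (\<phi> \<triangleright> Y) (N X) \<odot> \<xi> - \<Psi> X (\<phi> \<triangleright> \<phi> \<triangleright> Y)"
    using Psi_phi[of X "\<phi> \<triangleright> Y"] by (simp add: fscale_apply fun_eq_iff)
  have 3: "G (\<phi> \<triangleright> Y) (N X) = G (N X) (\<phi> \<triangleright> Y)"
    by (simp add: G_commute fun_eq_iff)
  show ?thesis
    by (simp add: K_def fscale_zero 1 2 3) (simp add: fscale_apply fun_eq_iff field_simps)
qed

text \<open>The restricted abstractions put the connection into the extensional function space
  demanded by \<open>linear_connection\<close>.\<close>

definition Dbar :: "real \<Rightarrow> 'm conn" where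
  "Dbar r = (\<lambda>X\<in>\<XX>. \<lambda>Y\<in>\<XX>. nabla X Y + K r X Y)"

lemma Dbar_eq [simp]: "X \<in> \<XX> \<Longrightarrow> Y \<in> \<XX> \<Longrightarrow> Dbar r X Y = nabla X Y + K r X Y"
  by (simp add: Dbar_def)

lemma linear_connection_Dbar: "linear_connection A (Dbar r)"
  unfolding linear_connection_def
proof (intro conjI ballI)
  show "Dbar r \<in> \<XX> \<rightarrow>\<^sub>E \<XX> \<rightarrow>\<^sub>E \<XX>"
    by (auto simp: Dbar_def)
qed (simp_all add: nabla.add_left nabla.add_right nabla.scale_left nabla.scale_right
    K_add_left K_add_right K_scale_left K_scale_right,
    simp_all add: fscale_apply fun_eq_iff algebra_simps)

lemma parallelizes_Dbar: "parallelizes A \<phi> \<xi> \<eta> g (Dbar r)"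
  unfolding parallelizes_def
proof (intro conjI ballI)
  fix X Y
  assume [simp]: "X \<in> \<XX>" "Y \<in> \<XX>"
  show "cov_endo (Dbar r) \<phi> X Y = 0"
    using K_phi[of X Y r] by (simp add: cov_endo_def algebra_simps)
  \<comment> \<open>Parallelism of \<eta> is skewness of \<open>K\<close> with \<xi> in the last
    slot, as \<eta> is dual to \<xi>.\<close>
  show "cov_form (Dbar r) \<eta> X Y = 0"
  proof
    fix p
    show "cov_form (Dbar r) \<eta> X Y p = 0 p"
      using K_skew[of X Y \<xi> r p] by (simp add: cov_form_def deriv_eta K_xi_right)
  qed
next
  fix X Y Z
  assume [simp]: "X \<in> \<XX>" "Y \<in> \<XX>" "Z \<in> \<XX>"
  show "cov_metric (Dbar r) g X Y Z = 0"
  proof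
    fix p
    show "cov_metric (Dbar r) g X Y Z p = 0 p"
      using K_skew[of X Y Z r p] by (simp add: cov_metric_def deriv_metric)
  qed
qed (simp add: K_xi_right)

section \<open>The torsion of \<open>Dbar\<close>\<close>

lemma torsion_Dbar:
  assumes [simp]: "X \<in> \<XX>" "Y \<in> \<XX>"
  shows "torsion (Dbar r) X Y = K r X Y - K r Y X"
  using torsion_free[of X Y] by (simp add: torsion_def algebra_simps)

text \<open>For arguments in ker \<eta> the right-hand side of the nearly Sasakian identity is a
  multiple of \<xi>, hence orthogonal to \<open>Z\<close>.\<close>

lemma Psi_skew_on_ker:
  assumes "X \<in> ker_sections A \<eta>" "Y \<in> ker_sections A \<eta>" "Z \<in> ker_sections A \<eta>"
  shows "G (\<Psi> Y X) Z p = - G (\<Psi> X Y) Z p"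
  using assms by (simp add: ker_sections_def Psi_nearly[of X Y])

lemma phi_ker [simp]: "X \<in> \<XX> \<Longrightarrow> \<phi> \<triangleright> X \<in> ker_sections A \<eta>"
  by (simp add: ker_sections_def fun_eq_iff)

lemma ker_vf: "X \<in> ker_sections A \<eta> \<Longrightarrow> X \<in> \<XX>"
  by (simp add: ker_sections_def)

text \<open>On \<open>ker \<eta>\<close> the form \<open>g((\<nabla>\<^sub>X\<phi>)Y, Z)\<close> is skew and \<open>\<phi>\<close> may be moved between its slots.\<close>

lemma torsion_Dbar_ker:
  assumes "X \<in> ker_sections A \<eta>" "Y \<in> ker_sections A \<eta>" "Z \<in> ker_sections A \<eta>"
  shows "G (torsion (Dbar r) X Y) Z p = G (\<Psi> (\<phi> \<triangleright> X) Y) Z p"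
proof -
  have [simp]: "X \<in> \<XX>" "Y \<in> \<XX>" "Z \<in> \<XX>"
    "(\<eta> \<triangleright> X) p = 0" "(\<eta> \<triangleright> Y) p = 0" "(\<eta> \<triangleright> Z) p = 0"
    using assms by (simp_all add: ker_sections_def)
  have "G (\<Psi> X (\<phi> \<triangleright> Y)) Z p = - G (\<phi> \<triangleright> \<Psi> X Y) Z p"
    by (simp add: Psi_phi)
  also have "\<dots> = G (\<Psi> X Y) (\<phi> \<triangleright> Z) p"
    by (simp add: G_phi_right)
  also have "\<dots> = - G (\<Psi> Y X) (\<phi> \<triangleright> Z) p"
    using Psi_skew_on_ker[of Y X "\<phi> \<triangleright> Z"] assms by simp
  also have "\<dots> = G (\<phi> \<triangleright> \<Psi> Y X) Z p"
    by (simp add: G_phi_right)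
  also have "\<dots> = - G (\<Psi> Y (\<phi> \<triangleright> X)) Z p"
    by (simp add: Psi_phi)
  \<comment> \<open>Hence the two terms with coefficient 1/2 in \<open>K r X Y - K r Y X\<close>
    have the same pairing with \<open>Z\<close> and add up.\<close>
  finally have "G (\<Psi> X (\<phi> \<triangleright> Y)) Z p = - G (\<Psi> Y (\<phi> \<triangleright> X)) Z p" .
  moreover have "G (\<Psi> (\<phi> \<triangleright> X) Y) Z p = - G (\<Psi> Y (\<phi> \<triangleright> X)) Z p"
    using Psi_skew_on_ker[of Y "\<phi> \<triangleright> X" Z] assms by simp
  ultimately show ?thesis
    by (simp add: torsion_Dbar K_def)
qed

lemma totally_skew_torsion_Dbar:
  "totally_skew_on (ker_sections A \<eta>) (\<lambda>X Y Z. G (torsion (Dbar r) X Y) Z)"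
  unfolding totally_skew_on_def
proof (intro ballI conjI)
  fix X Y Z
  assume ker: "X \<in> ker_sections A \<eta>" "Y \<in> ker_sections A \<eta>" "Z \<in> ker_sections A \<eta>"
  then have [simp]: "X \<in> \<XX>" "Y \<in> \<XX>" "Z \<in> \<XX>"
    by (simp_all add: ker_vf)
  show "G (torsion (Dbar r) Y X) Z = - G (torsion (Dbar r) X Y) Z"
    by (simp add: torsion_Dbar fun_eq_iff)
  \<comment> \<open>In the form given by \<open>torsion_Dbar_ker\<close>, skewness in the last two
    slots is \<open>Psi_skew\<close>.\<close>
  show "G (torsion (Dbar r) X Z) Y = - G (torsion (Dbar r) X Y) Z"
    by (simp add: torsion_Dbar_ker ker fun_eq_iff Psi_skew[of _ Z Y] G_commute[of Z])
qed

text \<open>Since \<open>N \<xi> = 0\<close>, only the first two terms of \<open>K r \<xi> X\<close>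
  survive; \<open>N X\<close> comes from \<open>K_xi_right\<close>.\<close>

lemma tau_Dbar:
  assumes [simp]: "X \<in> \<XX>"
  shows "torsion (Dbar r) \<xi> X
    = (\<lambda>p. 1/2) \<odot> \<Psi> \<xi> (\<phi> \<triangleright> X) - (\<lambda>p. r) \<odot> \<phi> \<triangleright> X + N X"
  by (simp add: torsion_Dbar K_xi_right) (simp add: K_def fscale_apply fun_eq_iff)

lemma adapted_connection_Dbar: "adapted_connection A \<phi> \<xi> \<eta> g r (Dbar r)"
proof -
  have "torsion (Dbar r) \<xi> (\<phi> \<triangleright> X) + \<phi> \<triangleright> torsion (Dbar r) \<xi> X
      = (\<lambda>p. - 2 * (r + 1)) \<odot> \<phi> \<triangleright> \<phi> \<triangleright> X" if [simp]: "X \<in> \<XX>" for X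
  proof -
    \<comment> \<open>The first term of \<open>tau_Dbar\<close> thus anticommutes with \<phi> and
      drops out of the condition.\<close>
    have "\<Psi> \<xi> (\<phi> \<triangleright> \<phi> \<triangleright> X) = - (\<phi> \<triangleright> \<Psi> \<xi> (\<phi> \<triangleright> X))"
      by (simp add: Psi_phi[of \<xi> "\<phi> \<triangleright> X"]) (simp add: fscale_apply fun_eq_iff)
    \<comment> \<open>This accounts for the summand 1 in the factor \<open>r + 1\<close>; the term
      with \<open>r\<close> in \<open>tau_Dbar\<close> accounts for the other.\<close>
    moreover have "N (\<phi> \<triangleright> X) = (\<lambda>p. - 2) \<odot> \<phi> \<triangleright> \<phi> \<triangleright> X - \<phi> \<triangleright> N X"
      using N_phi[of X] by (simp add: algebra_simps)
    ultimately show ?thesis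
      by (simp add: tau_Dbar) (simp add: fscale_apply fun_eq_iff algebra_simps)
  qed
  then show ?thesis
    by (simp add: adapted_connection_def linear_connection_Dbar parallelizes_Dbar
        totally_skew_torsion_Dbar Let_def)
qed

section \<open>Uniqueness\<close>

text \<open>Through this formula brackets, and with them torsions, inherit membership in
  \<open>\<XX>\<close>.\<close>

lemma lie_bracket_eq: "X \<in> \<XX> \<Longrightarrow> Y \<in> \<XX> \<Longrightarrow> lie_bracket X Y = nabla X Y - nabla Y X"
  using torsion_free[of X Y] by (simp add: torsion_def)

lemma adapted_connection_unique:
  assumes adapted: "adapted_connection A \<phi> \<xi> \<eta> g r D" "adapted_connection A \<phi> \<xi> \<eta> g r D'"
  shows "D = D'"
proof -
  interpret D: connection_on_manifold A D
    using adapted(1) manifold by unfold_locales (auto simp: adapted_connection_def)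
  interpret D': connection_on_manifold A D'
    using adapted(2) manifold by unfold_locales (auto simp: adapted_connection_def)
  define P where "P X Y = D X Y - D' X Y" for X Y
  let ?S = "\<lambda>X Y Z. G (P X Y) Z"
  let ?K = "ker_sections A \<eta>"

  have parallel: "parallelizes A \<phi> \<xi> \<eta> g D" "parallelizes A \<phi> \<xi> \<eta> g D'"
    using adapted by (auto simp: adapted_connection_def)
  have P_closed [simp]: "P X Y \<in> \<XX>" if "X \<in> \<XX>" "Y \<in> \<XX>" for X Y
    using that by (simp add: P_def)
  \<comment> \<open>A difference of connections is tensorial, so the splitting of \<open>X\<close>
    into its \<xi>-part and a section of ker \<eta> carries over to \<open>P\<close>.\<close>
  have P_decomp: "P X Y = (\<eta> \<triangleright> X) \<odot> P \<xi> Y - P (\<phi> \<triangleright> \<phi> \<triangleright> X) Y"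
    if [simp]: "X \<in> \<XX>" "Y \<in> \<XX>" for X Y
  proof -
    have "P X Y + P (\<phi> \<triangleright> \<phi> \<triangleright> X) Y = P (X + \<phi> \<triangleright> \<phi> \<triangleright> X) Y"
      by (simp add: P_def D.add_left D'.add_left)
    also have "X + \<phi> \<triangleright> \<phi> \<triangleright> X = (\<eta> \<triangleright> X) \<odot> \<xi>"
      by (simp add: phi_phi)
    also have "P \<dots> Y = (\<eta> \<triangleright> X) \<odot> P \<xi> Y"
      by (simp add: P_def D.scale_left D'.scale_left fscale_apply fun_eq_iff algebra_simps)
    finally show ?thesis
      by (simp add: fun_eq_iff eq_diff_eq)
  qed
  have P_xi: "P X \<xi> = 0" if "X \<in> \<XX>" for X
    using parallel that by (simp add: P_def parallelizes_def)
  have P_phi: "P X (\<phi> \<triangleright> Y) = \<phi> \<triangleright> P X Y" if [simp]: "X \<in> \<XX>" "Y \<in> \<XX>" for X Y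
  proof -
    have "cov_endo D \<phi> X Y = 0" "cov_endo D' \<phi> X Y = 0"
      using parallel by (auto simp: parallelizes_def)
    then show ?thesis
      by (simp add: P_def cov_endo_def)
  qed
  have S_skew: "?S X Z Y p = - ?S X Y Z p" if [simp]: "X \<in> \<XX>" "Y \<in> \<XX>" "Z \<in> \<XX>" for X Y Z p
  proof -
    have "cov_metric D g X Y Z p = 0" "cov_metric D' g X Y Z p = 0"
      using parallel by (auto simp: parallelizes_def)
    then show ?thesis
      by (simp add: P_def cov_metric_def G_commute[of Y])
  qed
  have eta_P: "(\<eta> \<triangleright> P X Y) p = 0" if [simp]: "X \<in> \<XX>" "Y \<in> \<XX>" for X Y p
    using S_skew[of X \<xi> Y p] by (simp add: P_xi)
  have S_phi_phi: "?S X (\<phi> \<triangleright> Y) (\<phi> \<triangleright> Z) p = ?S X Y Z p"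
    if [simp]: "X \<in> \<XX>" "Y \<in> \<XX>" "Z \<in> \<XX>" for X Y Z p
    by (simp add: P_phi G_phi_phi eta_P)
  have torsion_diff: "torsion D X Y - torsion D' X Y = P X Y - P Y X" for X Y
    by (simp add: torsion_def P_def)
  have torsion_closed [simp]: "torsion D X Y \<in> \<XX>" "torsion D' X Y \<in> \<XX>"
    if "X \<in> \<XX>" "Y \<in> \<XX>" for X Y
    using that by (simp_all add: torsion_def lie_bracket_eq)
  have S_swap: "?S Y X Z p = - ?S X Y Z p" if ker: "X \<in> ?K" "Y \<in> ?K" "Z \<in> ?K" for X Y Z p
  proof -
    have [simp]: "X \<in> \<XX>" "Y \<in> \<XX>" "Z \<in> \<XX>"
      using ker by (auto simp: ker_sections_def)
    have T: "?S U V W p - ?S V U W p = G (torsion D U V) W p - G (torsion D' U V) W p"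
      if "U \<in> \<XX>" "V \<in> \<XX>" "W \<in> \<XX>" for U V W
    proof -
      have "?S U V W p - ?S V U W p = G (P U V - P V U) W p"
        using that by simp
      also have "\<dots> = G (torsion D U V - torsion D' U V) W p"
        by (simp only: torsion_diff)
      finally show ?thesis
        using that by simp
    qed
    have "totally_skew_on ?K (\<lambda>X Y Z. G (torsion D X Y) Z)"
      "totally_skew_on ?K (\<lambda>X Y Z. G (torsion D' X Y) Z)"
      using adapted by (simp_all add: adapted_connection_def)
    then have "G (torsion D Z Y) X = - G (torsion D Z X) Y"
      "G (torsion D' Z Y) X = - G (torsion D' Z X) Y"
      using ker unfolding totally_skew_on_def by blast+
    then have "G (torsion D Z Y) X p - G (torsion D' Z Y) X p
        = - (G (torsion D Z X) Y p - G (torsion D' Z X) Y p)"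
      by simp
    \<comment> \<open>The two terms with \<open>Z\<close> in front cancel by \<open>S_skew\<close>;
      the other two give the exchange of \<open>X\<close> and \<open>Y\<close>.\<close>
    then have "?S Z Y X p - ?S Y Z X p = - (?S Z X Y p - ?S X Z Y p)"
      by (simp add: T)
    then show ?thesis
      using S_skew[of Z X Y p] S_skew[of Y X Z p] S_skew[of X Y Z p] by simp
  qed
  have S_move: "?S X (\<phi> \<triangleright> Y) Z p = - ?S X Y (\<phi> \<triangleright> Z) p"
    if [simp]: "X \<in> \<XX>" "Y \<in> \<XX>" "Z \<in> \<XX>" for X Y Z p
    by (simp add: P_phi G_phi_right)
  have S_ker: "?S (\<phi> \<triangleright> X) Y Z p = 0" if ker: "X \<in> ?K" "Y \<in> ?K" "Z \<in> ?K" for X Y Z p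
  proof -
    have [simp]: "X \<in> \<XX>" "Y \<in> \<XX>" "Z \<in> \<XX>"
      using ker by (auto simp: ker_sections_def)
    \<comment> \<open>Here \<phi> passes from \<open>X\<close> to \<open>Z\<close> and on to
      \<open>Y\<close>: two moves, so no sign remains.\<close>
    have "?S (\<phi> \<triangleright> X) Y Z p = - ?S Y (\<phi> \<triangleright> X) Z p"
      using ker by (simp add: S_swap[of Y "\<phi> \<triangleright> X" Z p] phi_ker)
    also have "\<dots> = ?S Y X (\<phi> \<triangleright> Z) p"
      by (simp add: S_move)
    also have "\<dots> = - ?S X Y (\<phi> \<triangleright> Z) p"
      using ker by (simp add: S_swap[of X Y "\<phi> \<triangleright> Z" p] phi_ker)
    also have "\<dots> = ?S X (\<phi> \<triangleright> Y) Z p"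
      by (simp add: S_move)
    finally have "?S (\<phi> \<triangleright> X) Y Z p = ?S X (\<phi> \<triangleright> Y) Z p" .
    \<comment> \<open>Now \<phi> passes from \<open>X\<close> to \<open>Y\<close> in a single move,
      which leaves a sign.\<close>
    moreover have "?S (\<phi> \<triangleright> X) Y Z p = - ?S X (\<phi> \<triangleright> Y) Z p"
    proof -
      have "?S (\<phi> \<triangleright> X) Y Z p = - ?S (\<phi> \<triangleright> X) Z Y p"
        by (rule S_skew) simp_all
      also have "\<dots> = ?S Z (\<phi> \<triangleright> X) Y p"
        using ker by (simp add: S_swap[of Z "\<phi> \<triangleright> X" Y p] phi_ker)
      also have "\<dots> = - ?S Z X (\<phi> \<triangleright> Y) p"
        by (simp add: S_move)
      also have "\<dots> = ?S X Z (\<phi> \<triangleright> Y) p"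
        using ker by (simp add: S_swap[of Z X "\<phi> \<triangleright> Y" p] phi_ker)
      also have "\<dots> = - ?S X (\<phi> \<triangleright> Y) Z p"
        by (rule S_skew) simp_all
      finally show ?thesis .
    qed
    ultimately show ?thesis
      by simp
  qed
  have P_xi_left: "P \<xi> Y = 0" if [simp]: "Y \<in> \<XX>" for Y
  proof -
    have "torsion D \<xi> (\<phi> \<triangleright> Y) + \<phi> \<triangleright> torsion D \<xi> Y = torsion D' \<xi> (\<phi> \<triangleright> Y) + \<phi> \<triangleright> torsion D' \<xi> Y"
      using adapted by (simp add: adapted_connection_def Let_def)
    \<comment> \<open>The other term of \<open>torsion_diff\<close>, namely
      \<open>P Z \<xi>\<close>, vanishes because both connections parallelize \<xi>.\<close>
    moreover have "torsion D \<xi> Z = torsion D' \<xi> Z + P \<xi> Z" if "Z \<in> \<XX>" for Z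
      using that torsion_diff[of \<xi> Z] by (simp add: P_xi algebra_simps)
    ultimately have "P \<xi> (\<phi> \<triangleright> Y) + \<phi> \<triangleright> P \<xi> Y = 0"
      by (simp add: algebra_simps)
    then have "\<phi> \<triangleright> P \<xi> Y = 0"
      by (simp add: P_phi fun_eq_iff)
    then show ?thesis
      by (rule phi_eta_eq_0[rotated]) (simp_all add: eta_P)
  qed
  have eq: "D X Y = D' X Y" if [simp]: "X \<in> \<XX>" "Y \<in> \<XX>" for X Y
  proof -
    have "P X Y = 0"
    proof (rule vf_eqI)
      fix Z p
      assume [simp]: "Z \<in> \<XX>"
      have "?S X Y Z p = - ?S (\<phi> \<triangleright> \<phi> \<triangleright> X) Y Z p"
        by (subst P_decomp) (simp_all add: P_xi_left fscale_zero)
      \<comment> \<open>Inserting \<phi> into the last two slots moves \<open>Y\<close> and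
        \<open>Z\<close> into ker \<eta>, where \<open>S_ker\<close> applies.\<close>
      also have "\<dots> = - ?S (\<phi> \<triangleright> \<phi> \<triangleright> X) (\<phi> \<triangleright> Y) (\<phi> \<triangleright> Z) p"
        by (simp add: S_phi_phi)
      also have "\<dots> = 0"
        by (simp add: S_ker phi_ker)
      finally show "?S X Y Z p = G 0 Z p"
        by simp
    qed simp_all
    then show ?thesis
      by (simp add: P_def)
  qed
  \<comment> \<open>Agreement on smooth fields gives equality of functions, as both connections are
    \<open>undefined\<close> elsewhere.\<close>
  have ext: "D \<in> \<XX> \<rightarrow>\<^sub>E \<XX> \<rightarrow>\<^sub>E \<XX>" "D' \<in> \<XX> \<rightarrow>\<^sub>E \<XX> \<rightarrow>\<^sub>E \<XX>"
    using D.connection D'.connection by (auto simp: linear_connection_def)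
  have "D X = D' X" if X: "X \<in> \<XX>" for X
    using PiE_ext[OF PiE_mem[OF ext(1) X] PiE_mem[OF ext(2) X]] eq[OF X] by blast
  then show ?thesis
    using PiE_ext[OF ext] by blast
qed

end

theorem theorem7p2:
  fixes A :: "('m::{t2_space, second_countable_topology}, 'e::euclidean_space) atlas"
    and \<phi> :: "'m \<Rightarrow> 'm tvec \<Rightarrow> 'm tvec"
    and \<xi> :: "'m vfield"
    and \<eta> :: "'m \<Rightarrow> 'm tvec \<Rightarrow> real"
    and g :: "'m \<Rightarrow> 'm tvec \<Rightarrow> 'm tvec \<Rightarrow> real"
    and nabla :: "'m conn"
    and h :: "'m vfield \<Rightarrow> 'm vfield"
    and H :: "'m vfield \<Rightarrow> 'm vfield \<Rightarrow> 'm vfield"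
    and r :: real and n :: nat
  assumes "smooth_manifold A" and "DIM('e) = 2 * n + 1"
    and "nearly_sasakian A \<phi> \<xi> \<eta> g nabla"
    and h: "\<And>X. X \<in> vector_fields A \<Longrightarrow> nabla X \<xi> = - (\<phi> \<triangleright> X) + h X"
    and H: "\<And>X Y. X \<in> vector_fields A \<Longrightarrow> Y \<in> vector_fields A \<Longrightarrow>
      H X Y = (\<lambda>p. 1/2) \<odot> cov_endo nabla \<phi> X (\<phi> \<triangleright> Y)
            - (\<lambda>p. r * (\<eta> \<triangleright> X) p) \<odot> (\<phi> \<triangleright> Y)
            + (\<eta> \<triangleright> Y) \<odot> (\<phi> \<triangleright> X - h X)
            - (\<lambda>p. 1/2 * ev2 g (\<phi> \<triangleright> X - h X) Y p) \<odot> \<xi>"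
  shows "(\<exists>!D. adapted_connection A \<phi> \<xi> \<eta> g r D) \<and>
    adapted_connection A \<phi> \<xi> \<eta> g r
      (\<lambda>X\<in>vector_fields A. \<lambda>Y\<in>vector_fields A. nabla X Y + H X Y)"
proof -
  interpret nearly_sasakian_manifold A \<phi> \<xi> \<eta> g nabla
    using assms(1,3) by unfold_locales
  have "H X Y = K r X Y" if [simp]: "X \<in> vector_fields A" "Y \<in> vector_fields A" for X Y
  proof -
    have "\<phi> \<triangleright> X - h X = - nabla X \<xi>"
      by (simp add: h)
    then show ?thesis
      by (simp add: H K_def) (simp add: fscale_apply fun_eq_iff)
  qed
  \<comment> \<open>\<open>H\<close> is prescribed on smooth fields only; the restricted
    abstractions look at no other values.\<close>
  then have "(\<lambda>X\<in>vector_fields A. \<lambda>Y\<in>vector_fields A. nabla X Y + H X Y) = Dbar r"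
    unfolding Dbar_def by (intro restrict_ext) simp
  then show ?thesis
    using adapted_connection_Dbar adapted_connection_unique by metis
qed

end
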